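(* Let $(E,d_E)$ be a complete separable metric space with Borel $\sigma$-algebra $\mathcal E$, let $\mu,\widetilde\mu$ be equivalent (mutually absolutely continuous) probability measures on $(E,\mathcal E)$, and let $\Phi\colon E\to[0,\infty)$ be measurable. Put $Z:=\int_E e^{-\Phi}\,d\mu$, $\widetilde Z:=\int_E e^{-\Phi}\,d\widetilde\mu$ and define the probability measures $$\mu_\Phi(dx):=\frac1Z e^{-\Phi(x)}\,\mu(dx),\qquad \widetilde\mu_\Phi(dx):=\frac1{\widetilde Z}e^{-\Phi(x)}\,\widetilde\mu(dx).$$ Then $$d_{\mathrm{KL}}(\mu_\Phi\|\widetilde\mu_\Phi)\le\frac1{\min(Z,\widetilde Z)}\left(d_{\mathrm{KL}}(\mu\|\widetilde\mu)+d_{\mathrm{KL}}(\widetilde\mu\|\mu)\right)\qquad\text{and}\qquad |Z-\widetilde Z|\le\sqrt{2\,d_{\mathrm{KL}}(\mu\|\widetilde\mu)}.$$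
   Context: The Kullback--Leibler divergence is $d_{\mathrm{KL}}(\mu\|\widetilde\mu):=\int_E\log\left(\frac{d\mu}{d\widetilde\mu}\right)d\mu\in[0,\infty]$ if $\mu\ll\widetilde\mu$, and $+\infty$ otherwise. *)

theory Defs
  imports "HOL-Probability.Probability"
begin

(* The library's KL_divergence is real-valued and returns 0 when the log-density is not integrable.
   Here the integral is taken in the extended sense (positive part minus negative part), so that it
   may be infinite.  RN_deriv N M is dM/dN; for finite measures with M << N it is finite and positive
   M-almost everywhere, so enn2real and ln 0 = 0 do not affect the value. *)
definition kl_div :: "'a measure \<Rightarrow> 'a measure \<Rightarrow> ereal" where
  "kl_div M N =
    (if absolutely_continuous N M then
       enn2ereal (\<integral>\<^sup>+x. ennreal (ln (enn2real (RN_deriv N M x))) \<partial>M) -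
       enn2ereal (\<integral>\<^sup>+x. ennreal (- ln (enn2real (RN_deriv N M x))) \<partial>M)
     else \<infinity>)"

lemma kl_div_eq_KL_divergence:
  assumes "absolutely_continuous N M"
    and int: "integrable M (\<lambda>x. ln (enn2real (RN_deriv N M x)))"
  shows "kl_div M N = ereal (KL_divergence (exp 1) N M)"
proof -
  let ?f = "\<lambda>x. ln (enn2real (RN_deriv N M x))"
  have fin: "(\<integral>\<^sup>+x. ennreal (?f x) \<partial>M) \<noteq> \<infinity>" "(\<integral>\<^sup>+x. ennreal (- ?f x) \<partial>M) \<noteq> \<infinity>"
    using int unfolding real_integrable_def by auto
  have diff: "enn2ereal p - enn2ereal q = ereal (enn2real p - enn2real q)"
    if "p \<noteq> \<infinity>" "q \<noteq> \<infinity>" for p q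
    using that by (cases p; cases q) (simp_all add: enn2ereal_ennreal)
  have "KL_divergence (exp 1) N M = integral\<^sup>L M ?f"
    by (simp add: KL_divergence_def entropy_density_def log_def comp_def)
  also have "\<dots> = enn2real (\<integral>\<^sup>+x. ennreal (?f x) \<partial>M) - enn2real (\<integral>\<^sup>+x. ennreal (- ?f x) \<partial>M)"
    by (rule real_lebesgue_integral_def[OF int])
  finally show ?thesis
    using assms(1) diff[OF fin] by (simp only: kl_div_def if_True)
qed

(* On negative arguments the odd extension is used, as for sqrt on the reals. *)
definition ereal_sqrt :: "ereal \<Rightarrow> ereal" where
  "ereal_sqrt x = (if \<bar>x\<bar> = \<infinity> then x else ereal (sqrt (real_of_ereal x)))"

lemma ereal_sqrt_simps [simp]:
  "ereal_sqrt (ereal r) = ereal (sqrt r)"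
  "ereal_sqrt \<infinity> = \<infinity>"
  "ereal_sqrt (- \<infinity>) = - \<infinity>"
  by (simp_all add: ereal_sqrt_def)

definition norm_const :: "'a measure \<Rightarrow> ('a \<Rightarrow> real) \<Rightarrow> real" where
  "norm_const M \<Phi> = (\<integral>x. exp (- \<Phi> x) \<partial>M)"

definition posterior :: "'a measure \<Rightarrow> ('a \<Rightarrow> real) \<Rightarrow> 'a measure" where
  "posterior M \<Phi> = density M (\<lambda>x. ennreal (1 / norm_const M \<Phi> * exp (- \<Phi> x)))"

lemma integrable_exp_neg:
  fixes \<Phi> :: "'a \<Rightarrow> real"
  assumes "prob_space M" "\<Phi> \<in> borel_measurable M" "\<And>x. 0 \<le> \<Phi> x"
  shows "integrable M (\<lambda>x. exp (- \<Phi> x))"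
proof -
  interpret prob_space M by fact
  show ?thesis
  proof (rule integrable_const_bound[where B = 1])
    show "AE x in M. norm (exp (- \<Phi> x)) \<le> 1"
      using assms(3) by (intro AE_I2) simp
    show "(\<lambda>x. exp (- \<Phi> x)) \<in> borel_measurable M"
      using assms(2) by measurable
  qed
qed

lemma norm_const_pos:
  assumes "prob_space M" "\<Phi> \<in> borel_measurable M" "\<And>x. 0 \<le> \<Phi> x"
  shows "0 < norm_const M \<Phi>"
proof -
  interpret prob_space M by fact
  have "norm_const M \<Phi> \<noteq> 0"
    unfolding norm_const_def
    using integral_nonneg_eq_0_iff_AE[OF integrable_exp_neg[OF assms]] by simp
  moreover have "0 \<le> norm_const M \<Phi>"
    by (simp add: norm_const_def)
  ultimately show ?thesis by simp
qed

lemma prob_space_posterior: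
  assumes "prob_space M" "\<Phi> \<in> borel_measurable M" "\<And>x. 0 \<le> \<Phi> x"
  shows "prob_space (posterior M \<Phi>)"
proof (rule prob_spaceI)
  note pos = norm_const_pos[OF assms] and int = integrable_exp_neg[OF assms]
  have "emeasure (posterior M \<Phi>) (space (posterior M \<Phi>)) =
      (\<integral>\<^sup>+x. ennreal (1 / norm_const M \<Phi> * exp (- \<Phi> x)) \<partial>M)"
    using assms(2) by (simp add: posterior_def emeasure_density cong: nn_integral_cong)
  also have "\<dots> = ennreal (\<integral>x. 1 / norm_const M \<Phi> * exp (- \<Phi> x) \<partial>M)"
    by (rule nn_integral_eq_integral) (use pos int in auto)
  also have "(\<integral>x. 1 / norm_const M \<Phi> * exp (- \<Phi> x) \<partial>M) = 1 / norm_const M \<Phi> * norm_const M \<Phi>"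
    unfolding norm_const_def by (rule integral_mult_right_zero)
  also have "ennreal \<dots> = 1"
    using pos by simp
  finally show "emeasure (posterior M \<Phi>) (space (posterior M \<Phi>)) = 1" .
qed

end

theory Submission
  imports Defs
begin

text \<open>Let \<open>D\<close> be the density of \<open>\<mu>\<close> with respect to \<open>\<mu>'\<close> and \<open>w = exp (- \<Phi>)\<close>. The integrand
\<open>D ln D - D + 1\<close> is nonnegative and integrates to \<open>d\<^sub>K\<^sub>L(\<mu>\<parallel>\<mu>')\<close>. Weighting it by \<open>w \<le> 1\<close> can only
decrease the integral, and the bound \<open>ln (Z'/Z) \<le> Z'/Z - 1\<close> on the normalisation gives the sharper
estimate \<open>Z d\<^sub>K\<^sub>L(\<mu>\<^sub>\<Phi>\<parallel>\<mu>'\<^sub>\<Phi>) \<le> d\<^sub>K\<^sub>L(\<mu>\<parallel>\<mu>')\<close>. For the normalisation constants, integrate the tangent bound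
\<open>D ln D - D + 1 \<ge> h D - exp h + 1\<close> with \<open>h = 2 \<Delta> (w - 1/2)\<close> and \<open>\<Delta> = Z - Z'\<close>; since \<open>\<bar>h\<bar> \<le> 1\<close>,
\<open>exp h \<le> 1 + h + h\<^sup>2\<close> and the result is \<open>\<Delta>\<^sup>2 \<le> d\<^sub>K\<^sub>L(\<mu>\<parallel>\<mu>')\<close>.\<close>

section \<open>Elementary inequalities for \<open>x * ln x\<close> and \<open>exp\<close>\<close>

text \<open>Fenchel-Young inequality for the conjugate pair \<open>d * ln d - d\<close> and
  \<open>exp h\<close>, obtained from \<open>ln t \<le> t - 1\<close> at
  \<open>t = exp h / d\<close>. The case \<open>h = 0\<close> gives nonnegativity of the right
  side.\<close>

lemma xlnx_tangent:
  fixes d h :: real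
  assumes "0 \<le> d"
  shows "h * d - exp h + 1 \<le> d * ln d - d + 1"
proof (cases "d = 0")
  case False
  with assms have d: "0 < d" by simp
  have "ln (exp h / d) \<le> exp h / d - 1"
    using d by (intro ln_le_minus_one) simp
  then have "d * (h - ln d) \<le> d * (exp h / d - 1)"
    using d by (simp add: ln_div)
  then show ?thesis
    using d by (simp add: algebra_simps)
qed simp

lemma exp_le_quadratic:
  fixes x :: real
  assumes "\<bar>x\<bar> \<le> 1"
  shows "exp x \<le> 1 + x + x\<^sup>2"
proof (cases "0 \<le> x")
  case True
  then show ?thesis using assms by (intro exp_bound) auto
next
  case False
  define y where "y = - x"
  have y: "0 \<le> y" "y \<le> 1" using False assms by (auto simp: y_def)
  \<comment> \<open>The product equals 1 plus the cube of \<open>y\<close>.\<close>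
  have "1 \<le> (1 + y) * (1 - y + y\<^sup>2)"
    using y by (simp add: algebra_simps power2_eq_square)
  also have "\<dots> \<le> exp y * (1 - y + y\<^sup>2)"
    using y by (intro mult_right_mono exp_ge_add_one_self) auto
  finally show ?thesis
    by (simp add: y_def exp_minus field_simps)
qed

section \<open>Divergence in terms of a real density\<close>

lemma prob_density_obtains:
  assumes "prob_space M" "prob_space N" "sets M = sets N" "absolutely_continuous N M"
  obtains D :: "'a \<Rightarrow> real" where "D \<in> borel_measurable N" "\<And>x. 0 \<le> D x"
    "M = density N (\<lambda>x. ennreal (D x))"
proof -
  interpret M: prob_space M by fact
  interpret N: prob_space N by fact
  obtain D where D: "D \<in> borel_measurable N" "AE x in N. RN_deriv N M x = ennreal (D x)"
      "AE x in M. 0 < D x" "\<And>x. 0 \<le> D x"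
    using N.real_RN_deriv[OF M.finite_measure_axioms assms(4,3)] by auto
  have "M = density N (RN_deriv N M)"
    using assms(3,4) by (simp add: N.density_RN_deriv)
  also have "\<dots> = density N D"
    using D by (intro density_cong) auto
  finally show ?thesis using that D by blast
qed

text \<open>Interpreted for the pair of priors and, inside the locale, once more for the pair of
  posteriors, so that \<open>kl_div_density\<close> serves both.\<close>

locale prob_density = prob_space N for N :: "'a measure" +
  fixes D :: "'a \<Rightarrow> real"
  assumes D_measurable [measurable]: "D \<in> borel_measurable N"
    and D_nonneg: "\<And>x. 0 \<le> D x"
    and prob_D: "prob_space (density N (\<lambda>x. ennreal (D x)))"
begin

abbreviation "M \<equiv> density N (\<lambda>x. ennreal (D x))"

lemma nn_integral_D: "(\<integral>\<^sup>+x. ennreal (D x) \<partial>N) = 1"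
  using prob_space.emeasure_space_1[OF prob_D]
  by (simp add: emeasure_density cong: nn_integral_cong)

lemma integrable_D: "integrable N D"
  using nn_integral_D D_nonneg by (intro integrableI_nonneg) auto

lemma integral_D: "(\<integral>x. D x \<partial>N) = 1"
  using nn_integral_D D_nonneg by (subst integral_eq_nn_integral) auto

lemma absolutely_continuous_D: "absolutely_continuous N M"
  by (intro absolutely_continuousI_density) simp

lemma RN_deriv_D: "AE x in N. RN_deriv N M x = ennreal (D x)"
  using D_nonneg by (intro density_unique density_RN_deriv_density) auto

lemma AE_ln_RN_deriv_D: "AE x in M. ln (enn2real (RN_deriv N M x)) = ln (D x)"
  using RN_deriv_D D_nonneg by (auto simp: AE_density)

lemma kl_div_density:
  assumes "integrable N (\<lambda>x. D x * ln (D x))"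
  shows "kl_div M N = ereal (\<integral>x. D x * ln (D x) \<partial>N)"
proof -
  have "integrable M (\<lambda>x. ln (D x))"
    using assms D_nonneg by (subst integrable_real_density) auto
  then have "integrable M (\<lambda>x. ln (enn2real (RN_deriv N M x)))"
    using AE_ln_RN_deriv_D by (subst integrable_cong_AE[where g="\<lambda>x. ln (D x)"]) auto
  then have "kl_div M N = ereal (KL_divergence (exp 1) N M)"
    by (intro kl_div_eq_KL_divergence absolutely_continuous_D)
  also have "KL_divergence (exp 1) N M = (\<integral>x. D x * log (exp 1) (D x) \<partial>N)"
    using D_nonneg by (intro KL_density) auto
  finally show ?thesis by (simp add: log_def)
qed

text \<open>The negative part of \<open>D x * ln (D x)\<close> is at most 1, hence integrable over a
  probability space; an infinite divergence can only come from the positive part.\<close>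

lemma integrable_of_kl_div_finite:
  assumes "kl_div M N \<noteq> \<infinity>"
  shows "integrable N (\<lambda>x. D x * ln (D x))"
proof -
  let ?R = "\<lambda>x. ln (enn2real (RN_deriv N M x))"
  \<comment> \<open>In \<open>ereal\<close>, \<open>\<infinity> - q = \<infinity>\<close> for every
    \<open>q\<close>, so an infinite positive part would already make \<open>kl_div\<close>
    infinite.\<close>
  have "(\<integral>\<^sup>+x. ennreal (?R x) \<partial>M) \<noteq> \<infinity>"
    using assms absolutely_continuous_D by (auto simp: kl_div_def)
  also have "(\<integral>\<^sup>+x. ennreal (?R x) \<partial>M) = (\<integral>\<^sup>+x. ennreal (ln (D x)) \<partial>M)"
    using AE_ln_RN_deriv_D by (intro nn_integral_cong_AE) auto
  also have "\<dots> = (\<integral>\<^sup>+x. ennreal (D x * ln (D x)) \<partial>N)"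
    using D_nonneg by (subst nn_integral_density) (auto simp: ennreal_mult' intro!: nn_integral_cong)
  finally have pos: "(\<integral>\<^sup>+x. ennreal (D x * ln (D x)) \<partial>N) \<noteq> \<infinity>" .
  have "- (D x * ln (D x)) \<le> 1" for x
    using xlnx_tangent[OF D_nonneg, of 0 x] D_nonneg[of x] by simp
  then have "(\<integral>\<^sup>+x. ennreal (- (D x * ln (D x))) \<partial>N) \<le> (\<integral>\<^sup>+x. 1 \<partial>N)"
    by (intro nn_integral_mono) (simp add: ennreal_le_1)
  also have "\<dots> = 1" by (simp add: emeasure_space_1)
  finally have neg: "(\<integral>\<^sup>+x. ennreal (- (D x * ln (D x))) \<partial>N) \<noteq> \<infinity>"
    by (auto simp: top_unique)
  show ?thesis
    using pos neg by (simp add: real_integrable_def)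
qed

text \<open>Gibbs' inequality: \<open>D x * ln (D x)\<close> dominates \<open>D x - 1\<close>, which
  has integral 0.\<close>

lemma kl_div_density_nonneg: "0 \<le> kl_div M N"
proof (cases "kl_div M N = \<infinity>")
  case False
  note int = integrable_of_kl_div_finite[OF False]
  have "0 = (\<integral>x. D x - 1 \<partial>N)"
    using integrable_D integral_D by (simp add: prob_space)
  also have "\<dots> \<le> (\<integral>x. D x * ln (D x) \<partial>N)"
  proof (intro integral_mono int)
    show "integrable N (\<lambda>x. D x - 1)" using integrable_D by simp
    show "D x - 1 \<le> D x * ln (D x)" for x
      using xlnx_tangent[OF D_nonneg, of 0 x] by simp
  qed
  finally show ?thesis using kl_div_density[OF int] by simp
qed simp

section \<open>Entropy estimates for a weight with values in the unit interval\<close>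

context
  fixes w :: "'a \<Rightarrow> real"
  assumes w_measurable [measurable]: "w \<in> borel_measurable N"
    and w_nonneg: "\<And>x. 0 \<le> w x" and w_le_1: "\<And>x. w x \<le> 1"
begin

lemma integrable_weighted:
  assumes "integrable N (g :: 'a \<Rightarrow> real)"
  shows "integrable N (\<lambda>x. w x * g x)"
proof (rule Bochner_Integration.integrable_bound[OF assms])
  show "(\<lambda>x. w x * g x) \<in> borel_measurable N"
    using assms by measurable
  show "AE x in N. norm (w x * g x) \<le> norm (g x)"
    using w_nonneg w_le_1 by (auto simp: abs_mult intro!: mult_left_le_one_le)
qed

lemma integrable_weight: "integrable N w"
  using integrable_weighted[of "\<lambda>_. 1"] by simp

text \<open>The left side is \<open>a\<close> times the divergence between the probability measures
  with \<open>N\<close>-densities \<open>w x * D x / a\<close> and \<open>w x / b\<close>. Weighting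
  the nonnegative integrand leaves a surplus \<open>b - a\<close>, which absorbs
  \<open>a * ln (b / a)\<close>.\<close>

lemma weighted_entropy_le:
  assumes int: "integrable N (\<lambda>x. D x * ln (D x))"
    and a: "a = (\<integral>x. w x * D x \<partial>N)" "0 < a" and b: "b = (\<integral>x. w x \<partial>N)" "0 < b"
  shows "(\<integral>x. w x * (D x * ln (D x)) \<partial>N) + a * ln (b / a) \<le> (\<integral>x. D x * ln (D x) \<partial>N)"
proof -
  have "(\<integral>x. w x * (D x * ln (D x)) - w x * D x + w x \<partial>N) \<le> (\<integral>x. D x * ln (D x) - D x + 1 \<partial>N)"
  proof (intro integral_mono)
    fix x
    have "w x * (D x * ln (D x) - D x + 1) \<le> D x * ln (D x) - D x + 1"
      using xlnx_tangent[OF D_nonneg, of 0 x] w_nonneg w_le_1 by (intro mult_left_le_one_le) auto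
    then show "w x * (D x * ln (D x)) - w x * D x + w x \<le> D x * ln (D x) - D x + 1"
      by (simp add: algebra_simps)
  qed (use int integrable_weighted integrable_weight integrable_D in auto)
  then have *: "(\<integral>x. w x * (D x * ln (D x)) \<partial>N) - a + b \<le> (\<integral>x. D x * ln (D x) \<partial>N)"
    using int integrable_weighted integrable_weight integrable_D integral_D
    by (simp add: a b prob_space)
  have "ln (b / a) \<le> b / a - 1"
    using a b by (intro ln_le_minus_one) simp
  then have "a * ln (b / a) \<le> a * (b / a - 1)"
    using a(2) by (intro mult_left_mono) auto
  also have "\<dots> = b - a" using a(2) by (simp add: field_simps)
  finally show ?thesis using * by linarith
qed

lemma weight_diff_squared_le:
  assumes int: "integrable N (\<lambda>x. D x * ln (D x))"
  shows "((\<integral>x. w x * D x \<partial>N) - (\<integral>x. w x \<partial>N))\<^sup>2 \<le> (\<integral>x. D x * ln (D x) \<partial>N)"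
proof -
  define c where "c = (\<integral>x. w x * D x \<partial>N) - (\<integral>x. w x \<partial>N)"
  \<comment> \<open>Both integrals lie between 0 and 1, so \<open>\<bar>c\<bar> \<le> 1\<close>;
    this puts \<open>h\<close> below in the range of \<open>exp_le_quadratic\<close>.\<close>
  have "0 \<le> (\<integral>x. w x * D x \<partial>N)" "0 \<le> (\<integral>x. w x \<partial>N)"
    using w_nonneg D_nonneg by auto
  moreover have "(\<integral>x. w x * D x \<partial>N) \<le> (\<integral>x. D x \<partial>N)"
    using w_nonneg w_le_1 D_nonneg integrable_weighted integrable_D
    by (auto intro!: integral_mono mult_left_le_one_le)
  moreover have "(\<integral>x. w x \<partial>N) \<le> (\<integral>x. 1 \<partial>N)"
    using w_le_1 integrable_weight by (intro integral_mono) auto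
  ultimately have c: "\<bar>c\<bar> \<le> 1"
    using integral_D by (simp add: c_def prob_space)
  \<comment> \<open>The left integrand is \<open>h * (D x - 1) - c\<^sup>2\<close>, what remains of
    the tangent bound after \<open>exp h \<le> 1 + h + c\<^sup>2\<close>. A slope \<open>t\<close>
    in place of \<open>c\<close> would integrate to \<open>2 * t * c - t\<^sup>2\<close>, which is
    largest at \<open>t = c\<close>.\<close>
  have "(\<integral>x. 2 * c * (w x * D x - w x) - c * (D x - 1) - c\<^sup>2 \<partial>N) \<le> (\<integral>x. D x * ln (D x) - D x + 1 \<partial>N)"
  proof (intro integral_mono)
    fix x
    \<comment> \<open>Centring \<open>w\<close> at 1/2 gives
      \<open>\<bar>h\<bar> \<le> \<bar>c\<bar>\<close>, and the shift costs nothing because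
      \<open>D x - 1\<close> has integral 0.\<close>
    define h where "h = c * (2 * w x - 1)"
    have w: "\<bar>2 * w x - 1\<bar> \<le> 1"
      using w_nonneg[of x] w_le_1[of x] by linarith
    have "\<bar>h\<bar> \<le> \<bar>c\<bar>"
      unfolding h_def abs_mult using w by (intro mult_left_le) auto
    then have "\<bar>h\<bar> \<le> 1" "h\<^sup>2 \<le> c\<^sup>2"
      using c by (simp_all only: abs_le_square_iff[symmetric] order_trans)
    then show "2 * c * (w x * D x - w x) - c * (D x - 1) - c\<^sup>2 \<le> D x * ln (D x) - D x + 1"
      using xlnx_tangent[OF D_nonneg, of h x] exp_le_quadratic[of h]
      by (simp add: h_def algebra_simps)
  qed (use int integrable_weighted integrable_weight integrable_D in auto)
  also have "(\<integral>x. 2 * c * (w x * D x - w x) - c * (D x - 1) - c\<^sup>2 \<partial>N) = 2 * c * c - c\<^sup>2"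
    using integrable_weighted integrable_weight integrable_D integral_D
    by (simp add: c_def prob_space)
  finally show ?thesis
    using int integrable_D integral_D by (simp add: c_def[symmetric] prob_space power2_eq_square)
qed

end

section \<open>Posteriors and normalising constants\<close>

lemma kl_div_posterior_le:
  assumes [measurable]: "\<Phi> \<in> borel_measurable N" and \<Phi>: "\<And>x. 0 \<le> \<Phi> x"
    and int: "integrable N (\<lambda>x. D x * ln (D x))"
  shows "kl_div (posterior M \<Phi>) (posterior N \<Phi>)
           \<le> ereal (1 / norm_const M \<Phi> * (\<integral>x. D x * ln (D x) \<partial>N))"
proof -
  define w where "w x = exp (- \<Phi> x)" for x
  have [measurable]: "w \<in> borel_measurable N" unfolding w_def by measurable
  have w: "0 \<le> w x" "w x \<le> 1" for x using \<Phi> by (auto simp: w_def)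
  define a where "a = norm_const M \<Phi>"
  define b where "b = norm_const N \<Phi>"
  have ab: "0 < a" "0 < b"
    unfolding a_def b_def using prob_D prob_space_axioms \<Phi> by (auto intro!: norm_const_pos)
  have a_eq: "a = (\<integral>x. w x * D x \<partial>N)"
    unfolding a_def norm_const_def w_def
    using D_nonneg by (subst integral_real_density) (auto simp: mult.commute)
  have b_eq: "b = (\<integral>x. w x \<partial>N)"
    by (simp add: b_def norm_const_def w_def)
  \<comment> \<open>In the quotient of the two posterior densities the weight \<open>w\<close>
    cancels; only the ratio of the normalising constants is left.\<close>
  define E where "E x = D x * b / a" for x
  have E: "0 \<le> E x" for x using D_nonneg ab by (simp add: E_def)
  have E_meas: "E \<in> borel_measurable N" unfolding E_def by measurable
  have post_N: "posterior N \<Phi> = density N (\<lambda>x. ennreal (w x / b))"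
    by (simp add: posterior_def w_def b_def)
  have post_M: "posterior M \<Phi> = density (posterior N \<Phi>) (\<lambda>x. ennreal (E x))"
    unfolding post_N unfolding posterior_def a_def[symmetric] w_def[symmetric]
    using D_nonneg ab w E E_meas
    by (auto simp: density_density_eq E_def ennreal_mult'[symmetric] mult_ac intro!: density_cong)
  have "prob_density (posterior N \<Phi>) E"
    unfolding prob_density_def prob_density_axioms_def post_M[symmetric]
  proof (intro conjI allI E)
    show "prob_space (posterior N \<Phi>)" "prob_space (posterior M \<Phi>)"
      using prob_D prob_space_axioms \<Phi> by (auto intro!: prob_space_posterior)
    show "E \<in> borel_measurable (posterior N \<Phi>)"
      using E_meas by (simp add: posterior_def)
  qed
  then interpret E: prob_density "posterior N \<Phi>" E .
  have ElnE: "w x / b * (E x * ln (E x)) = (w x * (D x * ln (D x)) + w x * D x * ln (b / a)) / a" for x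
  proof (cases "D x = 0")
    case False
    then have "ln (E x) = ln (D x) + ln (b / a)"
      using ab D_nonneg[of x] ln_mult[of "D x" "b / a"] by (simp add: E_def)
    then show ?thesis using ab by (simp add: E_def field_simps)
  qed (simp add: E_def)
  note int_w = integrable_weighted[OF _ w]
  have int_sum: "integrable N (\<lambda>x. w x / b * (E x * ln (E x)))"
    unfolding ElnE using int int_w integrable_D by auto
  have "integrable (posterior N \<Phi>) (\<lambda>x. E x * ln (E x))"
    unfolding post_N using int_sum w ab E_meas by (subst integrable_real_density) auto
  then have "kl_div (posterior M \<Phi>) (posterior N \<Phi>) = ereal (\<integral>x. E x * ln (E x) \<partial>posterior N \<Phi>)"
    using E.kl_div_density by (simp add: post_M)
  also have "(\<integral>x. E x * ln (E x) \<partial>posterior N \<Phi>) = (\<integral>x. w x / b * (E x * ln (E x)) \<partial>N)"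
    unfolding post_N using w ab E_meas by (subst integral_real_density) auto
  also have "\<dots> = ((\<integral>x. w x * (D x * ln (D x)) \<partial>N) + a * ln (b / a)) / a"
    unfolding ElnE using int int_w integrable_D by (simp add: a_eq)
  also have "\<dots> \<le> (\<integral>x. D x * ln (D x) \<partial>N) / a"
    using weighted_entropy_le[OF _ w int a_eq ab(1) b_eq ab(2)] ab
    by (intro divide_right_mono) auto
  finally show ?thesis by (simp add: a_def)
qed

lemma norm_const_diff_squared_le:
  assumes [measurable]: "\<Phi> \<in> borel_measurable N" and \<Phi>: "\<And>x. 0 \<le> \<Phi> x"
    and int: "integrable N (\<lambda>x. D x * ln (D x))"
  shows "(norm_const M \<Phi> - norm_const N \<Phi>)\<^sup>2 \<le> (\<integral>x. D x * ln (D x) \<partial>N)"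
proof -
  have "norm_const M \<Phi> = (\<integral>x. exp (- \<Phi> x) * D x \<partial>N)"
    unfolding norm_const_def
    using D_nonneg by (subst integral_real_density) (auto simp: mult.commute)
  then show ?thesis
    using weight_diff_squared_le[of "\<lambda>x. exp (- \<Phi> x)"] \<Phi> int by (simp add: norm_const_def)
qed

end

section \<open>Assembling the two bounds\<close>

text \<open>Applied in both directions: adding the reverse divergence, possibly infinite, then only
  enlarges the right side.\<close>

lemma kl_div_nonneg:
  assumes "prob_space M" "prob_space N" "sets M = sets N"
  shows "0 \<le> kl_div M N"
proof (cases "absolutely_continuous N M")
  case True
  obtain D where D: "D \<in> borel_measurable N" "\<And>x. 0 \<le> D x" "M = density N (\<lambda>x. ennreal (D x))"
    using prob_density_obtains[OF assms True] by blast
  then interpret prob_density N D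
    using assms by (simp add: prob_density_def prob_density_axioms_def)
  show ?thesis using kl_div_density_nonneg D by simp
qed (simp add: kl_div_def)

theorem theorem12:
  fixes \<mu> \<mu>' :: "'a::polish_space measure" and \<Phi> :: "'a \<Rightarrow> real"
  assumes "prob_space \<mu>" and "sets \<mu> = sets borel"
    and "prob_space \<mu>'" and "sets \<mu>' = sets borel"
    and "absolutely_continuous \<mu>' \<mu>" and "absolutely_continuous \<mu> \<mu>'"
    and "\<Phi> \<in> borel_measurable borel" and "\<And>x. 0 \<le> \<Phi> x"
  shows "kl_div (posterior \<mu> \<Phi>) (posterior \<mu>' \<Phi>)
           \<le> ereal (1 / min (norm_const \<mu> \<Phi>) (norm_const \<mu>' \<Phi>)) * (kl_div \<mu> \<mu>' + kl_div \<mu>' \<mu>)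
       \<and> ereal \<bar>norm_const \<mu> \<Phi> - norm_const \<mu>' \<Phi>\<bar> \<le> ereal_sqrt (2 * kl_div \<mu> \<mu>')"
proof -
  have sets: "sets \<mu> = sets \<mu>'" using assms by simp
  have meas: "\<Phi> \<in> borel_measurable \<mu>" "\<Phi> \<in> borel_measurable \<mu>'"
    using assms(7) by (simp_all add: measurable_cong_sets[OF assms(2) refl] measurable_cong_sets[OF assms(4) refl])
  define Z where "Z = norm_const \<mu> \<Phi>"
  define Z' where "Z' = norm_const \<mu>' \<Phi>"
  have Z: "0 < Z" "0 < Z'"
    unfolding Z_def Z'_def using norm_const_pos assms meas by blast+
  have nonneg: "0 \<le> kl_div \<mu> \<mu>'" "0 \<le> kl_div \<mu>' \<mu>"
    using kl_div_nonneg assms sets by metis+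
  obtain D where D: "D \<in> borel_measurable \<mu>'" "\<And>x. 0 \<le> D x" "\<mu> = density \<mu>' (\<lambda>x. ennreal (D x))"
    using prob_density_obtains[OF assms(1,3) sets assms(5)] by blast
  interpret prob_density \<mu>' D
    using assms D by (simp add: prob_density_def prob_density_axioms_def)
  show ?thesis
  proof (cases "kl_div \<mu> \<mu>' = \<infinity>")
    \<comment> \<open>Both right sides are infinite: the other summand is nonnegative, and the
      factor \<open>1 / min Z Z'\<close> is positive.\<close>
    case True
    then show ?thesis
      using Z nonneg by (simp add: Z_def[symmetric] Z'_def[symmetric] min_def)
  next
    case False
    define K where "K = (\<integral>x. D x * ln (D x) \<partial>\<mu>')"
    have int: "integrable \<mu>' (\<lambda>x. D x * ln (D x))"
      using integrable_of_kl_div_finite False D(3) by simp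
    have K: "kl_div \<mu> \<mu>' = ereal K"
      using kl_div_density[OF int] D(3) by (simp add: K_def)
    have "kl_div (posterior \<mu> \<Phi>) (posterior \<mu>' \<Phi>) \<le> ereal (1 / Z * K)"
      using kl_div_posterior_le[OF meas(2) assms(8) int] D(3) by (simp add: Z_def K_def)
    \<comment> \<open>Replacing \<open>Z\<close> by the minimum enlarges the bound because
      \<open>0 \<le> K\<close>.\<close>
    also have "\<dots> \<le> ereal (1 / min Z Z') * kl_div \<mu> \<mu>'"
      using Z nonneg(1) by (auto simp: K intro!: mult_right_mono divide_left_mono)
    also have "\<dots> \<le> ereal (1 / min Z Z') * (kl_div \<mu> \<mu>' + kl_div \<mu>' \<mu>)"
      using Z nonneg by (intro ereal_mult_left_mono add_increasing2) auto
    finally have 1: "kl_div (posterior \<mu> \<Phi>) (posterior \<mu>' \<Phi>)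
      \<le> ereal (1 / min Z Z') * (kl_div \<mu> \<mu>' + kl_div \<mu>' \<mu>)" .
    have "(Z - Z')\<^sup>2 \<le> K"
      using norm_const_diff_squared_le[OF meas(2) assms(8) int] D(3)
      by (simp add: Z_def Z'_def K_def)
    \<comment> \<open>The squared difference is already bounded by \<open>K\<close>; the factor 2
      only weakens this to the stated form.\<close>
    also have "\<dots> \<le> 2 * K"
      using nonneg(1) by (simp add: K)
    finally have "\<bar>Z - Z'\<bar>\<^sup>2 \<le> 2 * K" by simp
    then have "\<bar>Z - Z'\<bar> \<le> sqrt (2 * K)"
      by (rule real_le_rsqrt)
    then have "ereal \<bar>Z - Z'\<bar> \<le> ereal_sqrt (2 * kl_div \<mu> \<mu>')"
      by (simp add: K)
    with 1 show ?thesis by (simp add: Z_def Z'_def)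
  qed
qed

end
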